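(* Let $\mathcal X$ be finite dimensional and let $\mathcal R:\mathcal X\to\mathbb R$ be (real-valued,) proper, lower semi-continuous, strongly convex with constant $\kappa>0$, and separable, $\mathcal R(x)=\sum_{i=1}^b\mathcal R_i(x_i)$. Consider the RBCD method with convex regularization function $\mathcal R$ using the exact data $y$. If $0<\gamma<4\kappa/\|A\|^2$, then $\{x_k\}$ converges almost surely to a random solution $\bar x$ of $Ax=y$.
   Context: Let $b\ge1$, let $X_1,\dots,X_b$ and $\mathcal Y$ be real Hilbert spaces, and let $A_i:X_i\to\mathcal Y$ be bounded linear operators with adjoints $A_i^*$. Let $\mathcal X:=X_1\times\cdots\times X_b$ with the natural product inner product and define $A:\mathcal X\to\mathcal Y$, $Ax:=\sum_{i=1}^bA_ix_i$. It is assumed that $y\in\mathrm{Ran}(A)$. Strong convexity with constant $\kappa$ means $\mathcal R(tx+(1-t)\bar x)+\kappa t(1-t)\|x-\bar x\|^2\le t\mathcal R(x)+(1-t)\mathcal R(\bar x)$ for all $x,\bar x\in\mathrm{dom}(\mathcal R)$, $0\le t\le1$. Each $\mathcal R_i$ is a function on $X_i$. RBCD method with convex regularization function (exact data): let $i_0,i_1,\dots$ be independent random indices, each uniformly distributed on $\{1,\dots,b\}$. Let $\xi_0=0\in\mathcal X$ and $x_0:=\arg\min_{x\in\mathcal X}\mathcal R(x)$. With step size $\gamma>0$, for $k\ge0$ set $\xi_{k+1,i}=\xi_{k,i}$ and $x_{k+1,i}=x_{k,i}$ for $i\ne i_k$, and $$\xi_{k+1,i_k}=\xi_{k,i_k}-\gamma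 A_{i_k}^*(Ax_k-y),\qquad x_{k+1,i_k}=\arg\min_{z\in X_{i_k}}\{\mathcal R_{i_k}(z)-\langle\xi_{k+1,i_k},z\rangle\}.$$ *)

theory Defs
  imports "HOL-Probability.Probability"
begin

text \<open>
  The finite-dimensional Hilbert spaces \<open>X_1, \<dots>, X_b\<close> are represented by linear subspaces
  \<open>V i\<close> (\<open>i :: 'b\<close>, \<open>b = CARD('b) \<ge> 1\<close>) of one Euclidean space. This is no restriction: any finite
  family of finite-dimensional real Hilbert spaces, of possibly different (also zero) dimensions,
  embeds isometrically in a common Euclidean space. The product space is the following
  subspace of \<open>'a ^ 'b\<close>, whose inner product is the sum of the componentwise ones. Functions and
  operators on a subspace are total in HOL; all notions below use only their values on it.
\<close>

definition block_space :: "('b::finite \<Rightarrow> 'a set) \<Rightarrow> ('a ^ 'b) set" where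
  "block_space V = {x. \<forall>i. x $ i \<in> V i}"

definition bounded_linear_on :: "'a::real_normed_vector set \<Rightarrow> ('a \<Rightarrow> 'y::real_normed_vector) \<Rightarrow> bool"
  where
  "bounded_linear_on S f \<longleftrightarrow>
     (\<forall>u\<in>S. \<forall>v\<in>S. f (u + v) = f u + f v) \<and>
     (\<forall>c. \<forall>u\<in>S. f (c *\<^sub>R u) = c *\<^sub>R f u) \<and>
     (\<exists>K. \<forall>u\<in>S. norm (f u) \<le> K * norm u)"

definition onorm_on :: "'a::real_normed_vector set \<Rightarrow> ('a \<Rightarrow> 'y::real_normed_vector) \<Rightarrow> real" where
  "onorm_on S f = (SUP u\<in>S. norm (f u) / norm u)"

text \<open>The adjoint of \<open>f\<close> regarded as an operator from the Hilbert space \<open>S\<close>; its values lie in \<open>S\<close>.\<close>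

definition adjoint_on :: "'a::real_inner set \<Rightarrow> ('a \<Rightarrow> 'y::real_inner) \<Rightarrow> 'y \<Rightarrow> 'a" where
  "adjoint_on S f v = (THE w. w \<in> S \<and> (\<forall>u\<in>S. f u \<bullet> v = u \<bullet> w))"

definition block_op :: "('b::finite \<Rightarrow> 'a \<Rightarrow> 'y::real_vector) \<Rightarrow> 'a ^ 'b \<Rightarrow> 'y" where
  "block_op A x = (\<Sum>i\<in>UNIV. A i (x $ i))"

definition lsc_on :: "'a::topological_space set \<Rightarrow> ('a \<Rightarrow> real) \<Rightarrow> bool" where
  "lsc_on S f \<longleftrightarrow> (\<forall>x\<in>S. \<forall>c<f x. \<forall>\<^sub>F z in at x within S. c < f z)"

text \<open>Here the effective domain is all of \<open>S\<close>, as \<open>f\<close> is real-valued; for the same reason \<open>f\<close> is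
  proper whenever \<open>S\<close> is nonempty. Note the factor \<open>\<kappa>\<close> rather than \<open>\<kappa> / 2\<close>.\<close>

definition strongly_convex_on :: "'a::real_normed_vector set \<Rightarrow> real \<Rightarrow> ('a \<Rightarrow> real) \<Rightarrow> bool" where
  "strongly_convex_on S \<kappa> f \<longleftrightarrow>
     (\<forall>x\<in>S. \<forall>x'\<in>S. \<forall>t. 0 \<le> t \<and> t \<le> 1 \<longrightarrow>
        f (t *\<^sub>R x + (1 - t) *\<^sub>R x') + \<kappa> * t * (1 - t) * (norm (x - x'))\<^sup>2
          \<le> t * f x + (1 - t) * f x')"

text \<open>One RBCD step at block \<open>i\<close>, acting on the pair \<open>(\<xi>, x)\<close> of dual and primal iterates.\<close>

definition rbcd_step ::
  "('b::finite \<Rightarrow> 'a::real_inner set) \<Rightarrow> ('b \<Rightarrow> 'a \<Rightarrow> 'y::real_inner) \<Rightarrow> 'y \<Rightarrow>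
   ('b \<Rightarrow> 'a \<Rightarrow> real) \<Rightarrow> real \<Rightarrow> 'b \<Rightarrow> ('a ^ 'b) \<times> ('a ^ 'b) \<Rightarrow> ('a ^ 'b) \<times> ('a ^ 'b)" where
  "rbcd_step V A y Rs \<gamma> i = (\<lambda>(\<xi>, x).
     let \<eta> = \<xi> $ i - \<gamma> *\<^sub>R adjoint_on (V i) (A i) (block_op A x - y)
     in (\<chi> j. if j = i then \<eta> else \<xi> $ j,
         \<chi> j. if j = i then arg_min_on (\<lambda>z. Rs i z - \<eta> \<bullet> z) (V i) else x $ j))"

text \<open>The iterates \<open>(\<xi>\<^sub>k, x\<^sub>k)\<close> along a fixed sequence of block indices.\<close>

primrec rbcd ::
  "('b::finite \<Rightarrow> 'a::real_inner set) \<Rightarrow> ('b \<Rightarrow> 'a \<Rightarrow> 'y::real_inner) \<Rightarrow> 'y \<Rightarrow>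
   ('a ^ 'b \<Rightarrow> real) \<Rightarrow> ('b \<Rightarrow> 'a \<Rightarrow> real) \<Rightarrow> real \<Rightarrow> (nat \<Rightarrow> 'b) \<Rightarrow> nat \<Rightarrow>
   ('a ^ 'b) \<times> ('a ^ 'b)" where
  "rbcd V A y R Rs \<gamma> idx 0 = (0, arg_min_on R (block_space V))"
| "rbcd V A y R Rs \<gamma> idx (Suc k) = rbcd_step V A y Rs \<gamma> (idx k) (rbcd V A y R Rs \<gamma> idx k)"

end

theory Submission
  imports Defs
begin

text \<open>
  Let \<open>D_k(u)\<close> be the Bregman distance of \<open>R\<close> from \<open>(\<xi>_k, x_k)\<close> to a solution \<open>u\<close> of \<open>Ax = y\<close>. Strong
  convexity gives
  \<open>D_{k+1}(u) \<le> D_k(u) + \<langle>\<xi>_{k+1} - \<xi>_k, x_k - u\<rangle> + \<parallel>\<xi>_{k+1} - \<xi>_k\<parallel>^2 / (4 \<kappa>)\<close>; averaging over the random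
  block shows that \<open>D_k(u)\<close> is a nonnegative supermartingale whose expected decrease is at least a
  positive multiple of \<open>\<parallel>Ax_k - y\<parallel>^2\<close>. Hence almost surely \<open>Ax_k \<rightarrow> y\<close> and \<open>D_k(u)\<close> converges, for
  finitely many \<open>u\<close> at once. As \<open>D_k(u) - D_k(u')\<close> is affine in \<open>\<langle>\<xi>_k, u - u'\<rangle>\<close>, taking \<open>u\<close> and its
  translates by a basis of the kernel of \<open>A\<close> yields one null set outside of which \<open>D_k(u)\<close> converges
  for all solutions \<open>u\<close>, and thus also for a random cluster point of \<open>x_k\<close>. There the limit is \<open>0\<close>,
  because the \<open>\<xi>_k\<close> stay bounded, and \<open>\<kappa> \<parallel>x_k - u\<parallel>^2 \<le> D_k(u)\<close>.
\<close>

section \<open>Strongly convex functions on subspaces\<close>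

lemma strongly_convex_onD:
  assumes "strongly_convex_on S \<kappa> f" "x \<in> S" "x' \<in> S" "0 \<le> t" "t \<le> 1"
  shows "f (t *\<^sub>R x + (1 - t) *\<^sub>R x') + \<kappa> * t * (1 - t) * (norm (x - x'))\<^sup>2
    \<le> t * f x + (1 - t) * f x'"
  using assms unfolding strongly_convex_on_def by blast

lemma strongly_convex_on_diff_inner:
  fixes f :: "'a::real_inner \<Rightarrow> real"
  assumes "strongly_convex_on S \<kappa> f"
  shows "strongly_convex_on S \<kappa> (\<lambda>z. f z - \<eta> \<bullet> z)"
  using assms unfolding strongly_convex_on_def by (simp add: inner_simps algebra_simps)

text \<open>Compare \<open>x\<close> with points on the segment to \<open>z\<close>, divide the
  strong convexity inequality by \<open>t\<close> and let \<open>t\<close> tend to 0: the factor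
  \<open>1 - t\<close> disappears and the full constant \<kappa> remains.\<close>

lemma strongly_convex_on_growth:
  fixes f :: "'a::real_normed_vector \<Rightarrow> real"
  assumes sc: "strongly_convex_on S \<kappa> f" and S: "convex S"
    and x: "is_arg_min f (\<lambda>z. z \<in> S) x" and z: "z \<in> S"
  shows "f x + \<kappa> * (norm (z - x))\<^sup>2 \<le> f z"
proof -
  have xS: "x \<in> S" and min: "\<And>u. u \<in> S \<Longrightarrow> f x \<le> f u"
    using x by (auto simp: is_arg_min_linorder)
  have "f x + \<kappa> * (1 - t) * (norm (z - x))\<^sup>2 \<le> f z" if t: "0 < t" "t \<le> 1" for t
  proof -
    have "f x \<le> f (t *\<^sub>R z + (1 - t) *\<^sub>R x)"
      using t S xS z by (intro min) (simp add: convexD)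
    with strongly_convex_onD[OF sc z xS, of t] t
    have "t * (f x + \<kappa> * (1 - t) * (norm (z - x))\<^sup>2) \<le> t * f z"
      by (simp add: algebra_simps)
    then show ?thesis using t by simp
  qed
  moreover have "((\<lambda>t. f x + \<kappa> * (1 - t) * (norm (z - x))\<^sup>2) \<longlongrightarrow>
      f x + \<kappa> * (1 - 0) * (norm (z - x))\<^sup>2) (at_right 0)"
    by (intro tendsto_intros)
  ultimately have "f x + \<kappa> * (1 - 0) * (norm (z - x))\<^sup>2 \<le> f z"
    by (intro tendsto_upperbound[of _ _ "at_right 0"])
      (auto simp: eventually_at_right_field intro!: exI[of _ 1])
  then show ?thesis by simp
qed

text \<open>Composition with \<open>P\<close> extends functions from \<open>S\<close> to the whole
  space, which makes results about \<open>UNIV\<close> available on a subspace.\<close>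

lemma obtain_linear_retraction:
  fixes S :: "'a::euclidean_space set"
  assumes "subspace S"
  obtains P where "linear P" "\<And>x. P x \<in> S" "\<And>x. x \<in> S \<Longrightarrow> P x = x"
proof -
  have "\<exists>g. range g \<subseteq> S \<and> linear g \<and> (\<forall>v\<in>S. g (id v) = v)"
    using assms by (intro real_vector.linear_exists_left_inverse_on) (auto simp: linear_ident id_def)
  then show ?thesis using that by auto
qed

text \<open>Composition with a retraction onto \<open>S\<close> gives a finite convex function on
  the whole Euclidean space, and such functions are continuous.\<close>

lemma strongly_convex_on_continuous:
  fixes f :: "'a::euclidean_space \<Rightarrow> real"
  assumes sc: "strongly_convex_on S \<kappa> f" and "0 \<le> \<kappa>" and S: "subspace S"
  shows "continuous_on S f"
proof -
  obtain P where P: "linear P" "\<And>x. P x \<in> S" "\<And>x. x \<in> S \<Longrightarrow> P x = x"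
    using obtain_linear_retraction[OF S] by blast
  have "convex_on UNIV (\<lambda>x. f (P x))"
  proof (rule convex_onI)
    fix t :: real and x y :: 'a
    assume t: "0 < t" "t < 1"
    have "P ((1 - t) *\<^sub>R x + t *\<^sub>R y) = t *\<^sub>R P y + (1 - t) *\<^sub>R P x"
      using P(1) by (simp add: linear_add linear_cmul)
    moreover have "0 \<le> \<kappa> * t * (1 - t) * (norm (P y - P x))\<^sup>2" using t \<open>0 \<le> \<kappa>\<close> by simp
    ultimately show "f (P ((1 - t) *\<^sub>R x + t *\<^sub>R y)) \<le> (1 - t) * f (P x) + t * f (P y)"
      using strongly_convex_onD[OF sc P(2)[of y] P(2)[of x], of t] t by simp
  qed simp
  then have "continuous_on UNIV (\<lambda>x. f (P x))" by (rule convex_on_continuous[OF open_UNIV])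
  then have "continuous_on S (\<lambda>x. f (P x))" by (rule continuous_on_subset) simp
  then show ?thesis using P(3) by (subst continuous_on_cong[OF refl, of _ _ "\<lambda>x. f (P x)"]) auto
qed

text \<open>Compactness gives a minimum over a large ball. It is global because strong convexity
  keeps \<open>f\<close> at or above \<open>f 0\<close> outside that ball.\<close>

lemma strongly_convex_on_arg_min:
  fixes f :: "'a::euclidean_space \<Rightarrow> real"
  assumes sc: "strongly_convex_on S \<kappa> f" and \<kappa>: "0 < \<kappa>" and S: "subspace S"
  shows "is_arg_min f (\<lambda>z. z \<in> S) (arg_min_on f S)"
proof -
  have cont: "continuous_on S f" using strongly_convex_on_continuous[OF sc _ S] \<kappa> by simp
  have 0: "0 \<in> S" using S by (rule subspace_0)
  have attains: "\<exists>x\<in>cball 0 r \<inter> S. \<forall>z\<in>cball 0 r \<inter> S. f x \<le> f z" if "0 \<le> r" for r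
  proof (rule continuous_attains_inf)
    show "compact (cball 0 r \<inter> S)"
      using S by (intro compact_Int_closed closed_subspace) auto
    have "0 \<in> cball 0 r \<inter> S" using 0 that by simp
    then show "cball 0 r \<inter> S \<noteq> {}" by blast
  qed (use cont in \<open>auto intro: continuous_on_subset\<close>)
  obtain u where u: "u \<in> cball 0 1 \<inter> S" "\<And>z. z \<in> cball 0 1 \<inter> S \<Longrightarrow> f u \<le> f z"
    using attains[of 1] by auto
  define C where "C = f 0 - f u"
  have C: "0 \<le> C" using u(2)[of 0] 0 by (simp add: C_def)
  \<comment> \<open>Chosen so that \<open>\<kappa> * (norm z - 1)\<close> exceeds \<open>C\<close>
    whenever \<open>norm z > r\<close>. This is the convexity gain on the segment from 0 to
    \<open>z\<close>, evaluated where the segment leaves the unit ball.\<close>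
  define r where "r = 1 + C / \<kappa>"
  have r: "1 \<le> r" using C \<kappa> by (simp add: r_def)
  obtain x where x: "x \<in> cball 0 r \<inter> S" "\<And>z. z \<in> cball 0 r \<inter> S \<Longrightarrow> f x \<le> f z"
    using attains[of r] r by auto
  have "f x \<le> f z" if z: "z \<in> S" for z
  proof (cases "norm z \<le> r")
    case False
    define t where "t = 1 / norm z"
    have n: "1 < norm z" "C < \<kappa> * (norm z - 1)"
      using False r \<kappa> by (linarith, simp add: r_def field_simps)
    have t: "0 < t" "t \<le> 1" "t * norm z = 1"
      using n(1) less_trans[OF zero_less_one n(1)] by (auto simp: t_def simp del: zero_less_norm_iff)
    have "t *\<^sub>R z \<in> cball 0 1 \<inter> S"
      using S z t by (simp add: subspace_scale)
    then have "f u \<le> f (t *\<^sub>R z)" by (rule u(2))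
    with strongly_convex_onD[OF sc z 0, of t] t
    have "f u + \<kappa> * t * (1 - t) * (norm z)\<^sup>2 \<le> t * f z + (1 - t) * f 0" by simp
    moreover have "\<kappa> * t * (1 - t) * (norm z)\<^sup>2 = \<kappa> * (norm z - 1)"
    proof -
      have "\<kappa> * t * (1 - t) * (norm z)\<^sup>2 = \<kappa> * (t * norm z) * (norm z - t * norm z)"
        by (simp add: power2_eq_square algebra_simps)
      then show ?thesis by (simp add: t(3))
    qed
    ultimately have "f 0 \<le> t * f z + (1 - t) * f 0" using n by (simp add: C_def)
    then have "t * f 0 \<le> t * f z" by (simp add: algebra_simps)
    then have "f 0 \<le> f z" using t by simp
    moreover have "f x \<le> f 0" using x(2)[of 0] 0 r by simp
    ultimately show ?thesis by simp
  qed (use x z in auto)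
  then have "is_arg_min f (\<lambda>z. z \<in> S) x" using x by (auto simp: is_arg_min_linorder)
  then show ?thesis unfolding arg_min_on_def arg_min_def by (rule someI)
qed

section \<open>Operators on subspaces\<close>

text \<open>For existence, extend the functional by a retraction and project its Riesz vector
  orthogonally onto \<open>S\<close>. Uniqueness within \<open>S\<close> lets the definite
  description denote that vector.\<close>

lemma adjoint_on:
  fixes f :: "'a::euclidean_space \<Rightarrow> 'y::real_inner"
  assumes S: "subspace S" and f: "bounded_linear_on S f"
  shows "adjoint_on S f v \<in> S" and "u \<in> S \<Longrightarrow> u \<bullet> adjoint_on S f v = f u \<bullet> v"
proof -
  obtain P where P: "linear P" "\<And>x. P x \<in> S" "\<And>x. x \<in> S \<Longrightarrow> P x = x"
    using obtain_linear_retraction[OF S] by blast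
  let ?g = "\<lambda>u. f (P u) \<bullet> v"
  have g: "linear ?g"
    using f P by (intro linearI) (auto simp: bounded_linear_on_def linear_add linear_cmul inner_simps)
  \<comment> \<open>As \<open>?g\<close> is real-valued, \<open>adjoint ?g 1\<close> is its Riesz
    vector.\<close>
  obtain w w' where w: "w \<in> span S" "\<And>u. u \<in> span S \<Longrightarrow> orthogonal w' u" "adjoint ?g 1 = w + w'"
    using orthogonal_subspace_decomp_exists[of S "adjoint ?g 1"] by blast
  have wS: "w \<in> S" using w(1) S by (simp add: span_eq_iff[THEN iffD2])
  have w_eq: "f u \<bullet> v = u \<bullet> w" if u: "u \<in> S" for u
  proof -
    have "f u \<bullet> v = u \<bullet> adjoint ?g 1" using adjoint_works[OF g, of u 1] P(3)[OF u] by simp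
    also have "u \<bullet> w' = 0" using w(2)[OF span_base[OF u]] by (simp add: orthogonal_def inner_commute)
    then have "u \<bullet> adjoint ?g 1 = u \<bullet> w" by (simp add: w(3) inner_simps)
    finally show ?thesis .
  qed
  have unique: "x = w" if x: "x \<in> S" "\<forall>u\<in>S. f u \<bullet> v = u \<bullet> x" for x
  proof -
    have "x - w \<in> S" using S x(1) wS by (rule subspace_diff)
    then have "(x - w) \<bullet> (x - w) = 0" using x(2) w_eq by (simp add: inner_diff_right)
    then show ?thesis by simp
  qed
  have "adjoint_on S f v = w"
    unfolding adjoint_on_def using wS w_eq unique by (intro the_equality) auto
  then show "adjoint_on S f v \<in> S" "u \<in> S \<Longrightarrow> u \<bullet> adjoint_on S f v = f u \<bullet> v"
    using wS w_eq by auto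
qed

lemma bdd_above_onorm_on:
  assumes "bounded_linear_on S f"
  shows "bdd_above ((\<lambda>v. norm (f v) / norm v) ` S)"
proof -
  obtain K where K: "\<And>u. u \<in> S \<Longrightarrow> norm (f u) \<le> K * norm u"
    using assms unfolding bounded_linear_on_def by blast
  \<comment> \<open>\<open>K\<close> can be negative if \<open>S\<close> is trivial, while the
    quotient at 0 is 0 by the convention for division.\<close>
  have "norm (f v) / norm v \<le> max K 0" if "v \<in> S" for v
    using order_trans[OF K[OF that] mult_right_mono[OF max.cobounded1, of "norm v" K 0]]
    by (cases "v = 0") (auto simp: divide_le_eq)
  then show ?thesis by (intro bdd_aboveI2)
qed

lemma onorm_on:
  assumes "bounded_linear_on S f" "u \<in> S"
  shows "norm (f u) \<le> onorm_on S f * norm u"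
proof (cases "u = 0")
  case True
  obtain K where "norm (f u) \<le> K * norm u"
    using assms unfolding bounded_linear_on_def by blast
  then show ?thesis using True by simp
next
  case False
  have "norm (f u) / norm u \<le> onorm_on S f"
    unfolding onorm_on_def using assms by (intro cSUP_upper bdd_above_onorm_on)
  then show ?thesis using False by (simp add: divide_le_eq)
qed

lemma onorm_on_nonneg:
  assumes "bounded_linear_on S f" "u \<in> S"
  shows "0 \<le> onorm_on S f"
  using cSUP_upper[OF assms(2) bdd_above_onorm_on[OF assms(1)]]
  unfolding onorm_on_def by (rule order_trans[rotated]) simp

lemma bounded_linear_on_diff:
  assumes "bounded_linear_on S f" "subspace S" "u \<in> S" "v \<in> S"
  shows "f (u - v) = f u - f v"
proof -
  have "f (u + (-1) *\<^sub>R v) = f u + f ((-1) *\<^sub>R v)" "f ((-1) *\<^sub>R v) = (-1) *\<^sub>R f v"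
    using assms subspace_scale[OF assms(2,4), of "-1"] unfolding bounded_linear_on_def by blast+
  then show ?thesis by simp
qed

lemma subspace_block_space:
  assumes "\<And>i. subspace (V i)"
  shows "subspace (block_space V)"
  using assms unfolding subspace_def block_space_def by simp

lemma bounded_linear_on_block_op:
  fixes V :: "'b::finite \<Rightarrow> 'a::real_normed_vector set"
  assumes A: "\<And>i. bounded_linear_on (V i) (A i)"
  shows "bounded_linear_on (block_space V) (block_op A)"
proof -
  have "\<forall>i. \<exists>K. \<forall>u\<in>V i. norm (A i u) \<le> K * norm u"
    using A unfolding bounded_linear_on_def by blast
  then obtain K where K: "\<And>i u. u \<in> V i \<Longrightarrow> norm (A i u) \<le> K i * norm u" by metis
  have "norm (block_op A x) \<le> (\<Sum>i\<in>UNIV. \<bar>K i\<bar>) * norm x" if x: "x \<in> block_space V" for x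
    unfolding block_op_def sum_distrib_right
  proof (rule sum_norm_le)
    fix i
    have "norm (A i (x $ i)) \<le> K i * norm (x $ i)" using x by (intro K) (simp add: block_space_def)
    also have "\<dots> \<le> \<bar>K i\<bar> * norm x" by (intro mult_mono) (auto simp: Finite_Cartesian_Product.norm_nth_le)
    finally show "norm (A i (x $ i)) \<le> \<bar>K i\<bar> * norm x" .
  qed
  moreover have "A i (u + v) = A i u + A i v" if "u \<in> V i" "v \<in> V i" for i u v
    using A that unfolding bounded_linear_on_def by blast
  moreover have "A i (c *\<^sub>R u) = c *\<^sub>R A i u" if "u \<in> V i" for i u c
    using A that unfolding bounded_linear_on_def by blast
  ultimately show ?thesis
    unfolding bounded_linear_on_def
    by (intro conjI ballI allI exI) (auto simp: block_op_def block_space_def sum.distrib scaleR_sum_right)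
qed

section \<open>Supermartingales driven by uniform indices\<close>

text \<open>An even count means that the sequence is awaited below \<open>a\<close>, an odd one that it is awaited above \<open>c\<close>.\<close>

primrec crossings :: "real \<Rightarrow> real \<Rightarrow> (nat \<Rightarrow> real) \<Rightarrow> nat \<Rightarrow> nat" where
  "crossings a c X 0 = 0"
| "crossings a c X (Suc k) =
     (let s = crossings a c X k
      in if (if even s then X (Suc k) \<le> a else c \<le> X (Suc k)) then Suc s else s)"

lemma crossings_cong:
  "(\<And>j. j \<le> k \<Longrightarrow> X j = Y j) \<Longrightarrow> crossings a c X k = crossings a c Y k"
  by (induction k) (simp_all add: Let_def)

lemma mono_crossings: "mono (crossings a c X)"
  by (rule mono_iff_le_Suc[THEN iffD2]) (simp add: Let_def)

lemma crossings_unbounded: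
  assumes "\<exists>\<^sub>F k in sequentially. X k \<le> a" and "\<exists>\<^sub>F k in sequentially. c \<le> X k"
  shows "\<exists>k. n \<le> crossings a c X k"
proof (induction n)
  case (Suc n)
  then obtain k where k: "n \<le> crossings a c X k" by blast
  have "\<exists>j>k. if even n then X j \<le> a else c \<le> X j"
    using assms unfolding frequently_sequentially
    by (metis Suc_le_eq)
  then obtain j where j: "k < j" "if even n then X j \<le> a else c \<le> X j" by blast
  \<comment> \<open>The count at \<open>Suc i\<close> inspects \<open>X (Suc i)\<close>, and
    \<open>X 0\<close> is never inspected; \<open>k < j\<close> provides the predecessor.\<close>
  then obtain i where i: "j = Suc i" "k \<le> i" by (metis less_Suc_eq_le lessE less_imp_le)
  have "n \<le> crossings a c X i"
    using k monoD[OF mono_crossings i(2)] by (rule order_trans)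
  \<comment> \<open>If the count at \<open>i\<close> is still \<open>n\<close>, the value at
    \<open>j\<close> is one that it waits for; otherwise the count already exceeds
    \<open>n\<close>.\<close>
  then have "Suc n \<le> crossings a c X (Suc i)"
    using j(2) i(1) by (cases "crossings a c X i = n") (auto simp: Let_def)
  then show ?case by blast
qed simp

text \<open>\<open>B\<close> makes the liminf finite, and a gap between liminf and limsup would
  contain two rational levels visited alternately for ever. Rational levels keep the number of
  exceptional events countable in the application.\<close>

lemma convergent_if_not_oscillating:
  fixes X :: "nat \<Rightarrow> real"
  assumes "\<And>k. 0 \<le> X k"
    and bnd: "\<exists>\<^sub>F k in sequentially. X k \<le> B"
    and osc: "\<And>a c. a \<in> \<rat> \<Longrightarrow> c \<in> \<rat> \<Longrightarrow> 0 < a \<Longrightarrow> a < c \<Longrightarrow>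
      \<not> ((\<exists>\<^sub>F k in sequentially. X k \<le> a) \<and> (\<exists>\<^sub>F k in sequentially. c \<le> X k))"
  shows "convergent X"
proof -
  let ?Y = "\<lambda>k. ereal (X k)"
  have inf_le_sup: "liminf ?Y \<le> limsup ?Y" by (rule Liminf_le_Limsup) simp
  have inf_nonneg: "0 \<le> liminf ?Y" using assms(1) by (intro Liminf_bounded) auto
  have inf_le: "liminf ?Y \<le> ereal B"
  proof (rule ccontr)
    assume "\<not> liminf ?Y \<le> ereal B"
    then have "ereal B < liminf ?Y" by simp
    then have "\<forall>\<^sub>F k in sequentially. ereal B < ?Y k" by (rule less_LiminfD)
    then have "\<forall>\<^sub>F k in sequentially. \<not> X k \<le> B" by (rule eventually_mono) simp
    with bnd show False by (simp add: frequently_def)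
  qed
  have "limsup ?Y \<le> liminf ?Y"
  proof (rule ccontr)
    assume "\<not> limsup ?Y \<le> liminf ?Y"
    then have "liminf ?Y < limsup ?Y" by simp
    then obtain c' where c': "liminf ?Y < ereal c'" "ereal c' < limsup ?Y"
      using ereal_dense2 by blast
    obtain l where l: "liminf ?Y = ereal l"
      using inf_nonneg inf_le by (cases "liminf ?Y") auto
    have "0 \<le> l" "l < c'" using inf_nonneg c'(1) by (simp_all add: l)
    obtain c where c: "c \<in> \<rat>" "l < c" "c < c'" using Rats_dense_in_real[OF \<open>l < c'\<close>] by blast
    obtain a where a: "a \<in> \<rat>" "l < a" "a < c" using Rats_dense_in_real[OF \<open>l < c\<close>] by blast
    have "\<exists>\<^sub>F k in sequentially. X k \<le> a"
    proof (rule ccontr)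
      assume "\<not> ?thesis"
      then have "\<forall>\<^sub>F k in sequentially. ereal a \<le> ?Y k"
        by (simp add: not_frequently) (auto elim: eventually_mono)
      from Liminf_bounded[OF this] show False using a by (simp add: l)
    qed
    moreover have "\<exists>\<^sub>F k in sequentially. c \<le> X k"
    proof (rule ccontr)
      assume "\<not> ?thesis"
      then have "\<forall>\<^sub>F k in sequentially. ?Y k \<le> ereal c"
        by (simp add: not_frequently) (auto elim: eventually_mono)
      from Limsup_bounded[OF this] have "limsup ?Y \<le> ereal c" .
      also have "\<dots> < ereal c'" using c by simp
      finally show False using c' by simp
    qed
    ultimately show False using osc[OF a(1) c(1)] a \<open>0 \<le> l\<close> by auto
  qed
  with inf_le_sup have eq: "liminf ?Y = limsup ?Y" by simp
  obtain l where l: "liminf ?Y = ereal l"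
    using inf_nonneg inf_le by (cases "liminf ?Y") auto
  have "?Y \<longlonglongrightarrow> ereal l"
    using eq l by (intro Liminf_eq_Limsup) simp_all
  then have "X \<longlonglongrightarrow> l" by simp
  then show ?thesis by (rule convergentI)
qed

section \<open>Processes as functions of finite index words\<close>

locale uniform_indices = prob_space M for M :: "'w measure" +
  fixes I :: "nat \<Rightarrow> 'w \<Rightarrow> 'b::finite"
  assumes indep: "indep_vars (\<lambda>_. count_space UNIV) I UNIV"
    and uniform: "\<And>k. distr M (count_space UNIV) (I k) = uniform_count_measure UNIV"
begin

text \<open>A process adapted to the indices has the form
  \<open>F (index_prefix k \<omega>)\<close>, and its conditional expectation one step ahead is the
  average of \<open>F (l @ [i])\<close> over \<open>i\<close>. Supermartingales thus become
  inequalities on words, without filtrations.\<close>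

definition index_prefix :: "nat \<Rightarrow> 'w \<Rightarrow> 'b list" where
  "index_prefix k \<omega> = map (\<lambda>j. I j \<omega>) [0..<k]"

lemma length_index_prefix [simp]: "length (index_prefix k \<omega>) = k"
  by (simp add: index_prefix_def)

lemma take_index_prefix: "j \<le> k \<Longrightarrow> take j (index_prefix k \<omega>) = index_prefix j \<omega>"
  by (simp add: index_prefix_def take_map)

lemma measurable_index [measurable]: "I k \<in> M \<rightarrow>\<^sub>M count_space UNIV"
  using indep by (simp add: indep_vars_def)

lemma measurable_index_prefix [measurable]: "index_prefix k \<in> M \<rightarrow>\<^sub>M count_space UNIV"
proof (induction k)
  case 0
  then show ?case by (simp add: index_prefix_def)
next
  case (Suc k)
  have "(\<lambda>\<omega>. index_prefix k \<omega> @ [i]) \<in> M \<rightarrow>\<^sub>M count_space UNIV" for i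
    using measurable_compose[OF Suc measurable_count_space] .
  then have "(\<lambda>\<omega>. index_prefix k \<omega> @ [I k \<omega>]) \<in> M \<rightarrow>\<^sub>M count_space UNIV"
    by (rule measurable_compose_countable) (rule measurable_index)
  then show ?case by (simp add: index_prefix_def)
qed

lemma measurable_of_index_prefix:
  "f \<in> UNIV \<rightarrow> space N \<Longrightarrow> (\<lambda>\<omega>. f (index_prefix k \<omega>)) \<in> M \<rightarrow>\<^sub>M N"
  by (rule measurable_compose[OF measurable_index_prefix]) simp

lemma borel_of_index_prefix [measurable]: "(\<lambda>\<omega>. f (index_prefix k \<omega>)) \<in> borel_measurable M"
  by (rule measurable_of_index_prefix) simp

lemma prob_index: "prob (I k -` {i} \<inter> space M) = 1 / CARD('b)"
proof -
  have "prob (I k -` {i} \<inter> space M) = measure (distr M (count_space UNIV) (I k)) {i}"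
    by (simp add: measure_distr)
  then show ?thesis by (simp add: uniform measure_uniform_count_measure)
qed

lemma prob_index_prefix:
  assumes "length l = k"
  shows "prob {\<omega> \<in> space M. index_prefix k \<omega> = l} = 1 / CARD('b) ^ k"
\<comment> \<open>An intersection over the empty index set would be \<open>UNIV\<close> rather than
  \<open>space M\<close>, so the empty word is treated apart.\<close>
proof (cases "k = 0")
  case True
  then show ?thesis using assms by (simp add: index_prefix_def prob_space)
next
  case False
  have "{\<omega> \<in> space M. index_prefix k \<omega> = l} = (\<Inter>j\<in>{..<k}. I j -` {l ! j} \<inter> space M)"
    using False assms by (auto simp: index_prefix_def list_eq_iff_nth_eq)
  also have "prob \<dots> = (\<Prod>j\<in>{..<k}. prob (I j -` {l ! j} \<inter> space M))"
    using False by (intro indep_varsD[OF indep]) auto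
  also have "\<dots> = 1 / CARD('b) ^ k" by (simp add: prob_index power_divide)
  finally show ?thesis .
qed

lemma finite_words [simp]: "finite {l :: 'b list. length l = k}"
  using finite_lists_length_eq[of "UNIV :: 'b set" k] by simp

text \<open>Only finitely many words of length \<open>k\<close> occur, all equally likely, so the
  variable is a finite sum of scaled indicators and integrability holds for every
  \<open>F\<close>.\<close>

lemma has_bochner_integral_index_prefix:
  fixes F :: "'b list \<Rightarrow> real"
  shows "has_bochner_integral M (\<lambda>\<omega>. F (index_prefix k \<omega>))
    ((\<Sum>l | length l = k. F l) / CARD('b) ^ k)"
proof -
  let ?E = "\<lambda>l. {\<omega> \<in> space M. index_prefix k \<omega> = l}"
  have "has_bochner_integral M (\<lambda>\<omega>. \<Sum>l | length l = k. indicator (?E l) \<omega> *\<^sub>R F l)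
    (\<Sum>l | length l = k. measure M (?E l) *\<^sub>R F l)"
    by (intro has_bochner_integral_sum has_bochner_integral_indicator)
      (auto simp: emeasure_eq_measure)
  moreover have "(\<Sum>l | length l = k. measure M (?E l) *\<^sub>R F l)
      = (\<Sum>l | length l = k. F l) / CARD('b) ^ k"
    unfolding sum_divide_distrib by (intro sum.cong refl) (simp add: prob_index_prefix)
  moreover have "(\<Sum>l | length l = k. indicator (?E l) \<omega> *\<^sub>R F l) = F (index_prefix k \<omega>)"
    if "\<omega> \<in> space M" for \<omega>
  proof -
    have "(\<Sum>l | length l = k. indicator (?E l) \<omega> *\<^sub>R F l)
        = (\<Sum>l | length l = k. if index_prefix k \<omega> = l then F l else 0)"
      using that by (intro sum.cong) (auto simp: indicator_def)
    then show ?thesis by simp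
  qed
  ultimately show ?thesis by (subst has_bochner_integral_cong[OF refl _ refl]) auto
qed

lemma sum_words_Suc:
  fixes F :: "'b list \<Rightarrow> real"
  shows "(\<Sum>l | length l = Suc k. F l) = (\<Sum>l | length l = k. \<Sum>i\<in>UNIV. F (l @ [i]))"
proof -
  have "(\<Sum>l | length l = k. \<Sum>i\<in>UNIV. F (l @ [i]))
      = (\<Sum>(l, i) \<in> {l. length l = k} \<times> UNIV. F (l @ [i]))"
    by (rule sum.cartesian_product)
  also have "\<dots> = (\<Sum>l | length l = Suc k. F l)"
    by (rule sum.reindex_bij_witness[where i = "\<lambda>l. (butlast l, last l)" and j = "\<lambda>(l, i). l @ [i]"])
      (auto simp: snoc_eq_iff_butlast length_Suc_conv_rev)
  finally show ?thesis by simp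
qed

text \<open>The unnormalised sums over words grow by at most the factor \<open>CARD('b)\<close> per
  letter, which the probability of a word cancels.\<close>

lemma expectation_supermartingale_le:
  fixes F :: "'b list \<Rightarrow> real"
  assumes super: "\<And>l. (\<Sum>i\<in>UNIV. F (l @ [i])) \<le> CARD('b) * F l"
  shows "expectation (\<lambda>\<omega>. F (index_prefix k \<omega>)) \<le> F []"
proof -
  have "(\<Sum>l | length l = k. F l) \<le> CARD('b) ^ k * F []"
  proof (induction k)
    case (Suc k)
    have "(\<Sum>l | length l = Suc k. F l) \<le> (\<Sum>l | length l = k. CARD('b) * F l)"
      unfolding sum_words_Suc by (intro sum_mono super)
    also have "\<dots> = CARD('b) * (\<Sum>l | length l = k. F l)" by (simp add: sum_distrib_left)
    also have "\<dots> \<le> CARD('b) * (CARD('b) ^ k * F [])" using Suc by (intro mult_left_mono) auto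
    finally show ?case by (simp add: mult.assoc)
  qed simp
  then have "(\<Sum>l | length l = k. F l) / CARD('b) ^ k \<le> F []"
    by (simp add: divide_le_eq mult.commute)
  then show ?thesis
    using has_bochner_integral_integral_eq[OF has_bochner_integral_index_prefix[of F k]] by simp
qed

lemma integrable_of_index_prefix: "integrable M (\<lambda>\<omega>. F (index_prefix k \<omega>) :: real)"
  using has_bochner_integral_index_prefix by (rule integrable.intros)

text \<open>Dubins' inequality: the stake \<open>W\<close> of a gambler who buys when the process falls below \<open>a\<close>,
  sells when it exceeds \<open>c\<close> and retires after \<open>m\<close> sales is a supermartingale.\<close>

lemma prob_crossings_le:
  fixes F :: "'b list \<Rightarrow> real"
  assumes nonneg: "\<And>l. 0 \<le> F l"
    and super: "\<And>l. (\<Sum>i\<in>UNIV. F (l @ [i])) \<le> CARD('b) * F l"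
    and "0 < a" "a < c"
  shows "prob {\<omega> \<in> space M. 2 * m \<le> crossings a c (\<lambda>j. F (index_prefix j \<omega>)) k} \<le> (a / c) ^ m"
proof -
  define s where "s l = crossings a c (\<lambda>j. F (take j l)) (length l)" for l
  \<comment> \<open>\<open>s l div 2\<close> counts completed sales, and an odd \<open>s l\<close>
    means that the asset is held. Purchases are booked at \<open>a\<close> and sales at
    \<open>c\<close> even if the actual price is better, so a trade can only lower the
    value.\<close>
  define W where "W l = (if 2 * m \<le> s l then (c / a) ^ m
    else (c / a) ^ (s l div 2) * (if even (s l) then 1 else F l / a))" for l
  have s_prefix: "s (index_prefix k \<omega>) = crossings a c (\<lambda>j. F (index_prefix j \<omega>)) k" for k \<omega>
    unfolding s_def by (simp, rule crossings_cong) (simp add: take_index_prefix)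
  have s_snoc: "s (l @ [i]) = (if (if even (s l) then F (l @ [i]) \<le> a else c \<le> F (l @ [i]))
      then Suc (s l) else s l)" for l i
  proof -
    have "crossings a c (\<lambda>j. F (take j (l @ [i]))) (length l) = s l"
      unfolding s_def by (rule crossings_cong) simp
    then show ?thesis by (simp add: s_def Let_def)
  qed
  have W_nonneg: "0 \<le> W l" for l
    using nonneg \<open>0 < a\<close> \<open>a < c\<close> by (simp add: W_def)
  have W_super: "(\<Sum>i\<in>UNIV. W (l @ [i])) \<le> CARD('b) * W l" for l
  proof (cases "2 * m \<le> s l")
    case True
    then have "W (l @ [i]) = W l" for i by (simp add: W_def s_snoc)
    then show ?thesis by simp
  next
    case False
    let ?w = "(c / a) ^ (s l div 2)"
    have w: "0 < ?w" using assms by simp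
    show ?thesis
    proof (cases "even (s l)")
      case True
      have "W (l @ [i]) \<le> ?w" for i
        using False True w \<open>0 < a\<close> by (auto simp: W_def s_snoc divide_le_eq)
      then have "(\<Sum>i\<in>UNIV. W (l @ [i])) \<le> (\<Sum>i\<in>(UNIV::'b set). ?w)" by (intro sum_mono)
      then show ?thesis using False True by (simp add: W_def)
    next
      case odd: False
      have "W (l @ [i]) \<le> ?w * (F (l @ [i]) / a)" for i
      proof (cases "c \<le> F (l @ [i])")
        case True
        \<comment> \<open>A sale completes a round and raises the exponent by one. If the count
          thereby reaches \<open>2 * m\<close>, both branches of \<open>W\<close> give
          \<open>(c / a) ^ m\<close>.\<close>
        have 1: "Suc (s l) div 2 = Suc (s l div 2)" using odd by (simp add: odd_Suc_div_two)
        have 2: "m = Suc (s l div 2)" if "2 * m \<le> Suc (s l)" using that False odd by presburger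
        have "W (l @ [i]) = ?w * (c / a)"
          using True odd 1 2 by (auto simp: W_def s_snoc)
        also have "\<dots> \<le> ?w * (F (l @ [i]) / a)"
          using True w \<open>0 < a\<close> by (intro mult_left_mono divide_right_mono) auto
        finally show ?thesis .
      next
        case less: False
        then show ?thesis using False odd by (simp add: W_def s_snoc)
      qed
      then have "(\<Sum>i\<in>UNIV. W (l @ [i])) \<le> (\<Sum>i\<in>UNIV. ?w / a * F (l @ [i]))"
        by (intro sum_mono) simp
      also have "\<dots> = ?w / a * (\<Sum>i\<in>UNIV. F (l @ [i]))" by (simp add: sum_distrib_left)
      also have "\<dots> \<le> ?w / a * (CARD('b) * F l)"
        using w \<open>0 < a\<close> by (intro mult_left_mono super) auto
      also have "\<dots> = CARD('b) * W l" using False odd by (simp add: W_def)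
      finally show ?thesis .
    qed
  qed
  define E where "E = {\<omega> \<in> space M. 2 * m \<le> s (index_prefix k \<omega>)}"
  have E_sets: "E \<in> sets M" unfolding E_def by measurable
  \<comment> \<open>Markov's inequality: \<open>W\<close> is nonnegative and equals
    \<open>(c / a) ^ m\<close> on \<open>E\<close>.\<close>
  have "(c / a) ^ m * prob E = expectation (\<lambda>\<omega>. (c / a) ^ m * indicator E \<omega>)"
    using E_sets by simp
  also have "\<dots> \<le> expectation (\<lambda>\<omega>. W (index_prefix k \<omega>))"
  proof (rule integral_mono)
    show "integrable M (\<lambda>\<omega>. (c / a) ^ m * indicator E \<omega>)"
      using E_sets by (intro integrable_mult_right integrable_real_indicator) (auto simp: emeasure_eq_measure)
    show "(c / a) ^ m * indicator E \<omega> \<le> W (index_prefix k \<omega>)" for \<omega>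
      using W_nonneg[of "index_prefix k \<omega>"] by (cases "\<omega> \<in> E") (auto simp: E_def W_def)
  qed (rule integrable_of_index_prefix)
  also have "\<dots> \<le> W []" by (rule expectation_supermartingale_le) (rule W_super)
  also have "\<dots> \<le> 1" by (simp add: W_def s_def)
  finally have "(c / a) ^ m * prob E \<le> 1" .
  then have "prob E \<le> (a / c) ^ m" using assms by (simp add: power_divide field_simps)
  then show ?thesis by (simp add: E_def s_prefix)
qed

text \<open>Doob's convergence theorem. Dubins' bound, with first \<open>k\<close> and then
  \<open>m\<close> tending to infinity, excludes infinitely many crossings of each rational pair;
  Fatou's lemma excludes divergence to infinity.\<close>

lemma AE_convergent_supermartingale:
  fixes F :: "'b list \<Rightarrow> real"
  assumes nonneg: "\<And>l. 0 \<le> F l"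
    and super: "\<And>l. (\<Sum>i\<in>UNIV. F (l @ [i])) \<le> CARD('b) * F l"
  shows "AE \<omega> in M. convergent (\<lambda>k. F (index_prefix k \<omega>))"
proof -
  let ?X = "\<lambda>\<omega> k. F (index_prefix k \<omega>)"
  have osc: "AE \<omega> in M. \<not> ((\<exists>\<^sub>F k in sequentially. ?X \<omega> k \<le> a) \<and> (\<exists>\<^sub>F k in sequentially. c \<le> ?X \<omega> k))"
    if ac: "0 < a" "a < c" for a c
  proof -
    define s where "s l = crossings a c (\<lambda>j. F (take j l)) (length l)" for l
    have s_prefix: "s (index_prefix k \<omega>) = crossings a c (?X \<omega>) k" for k \<omega>
      unfolding s_def by (simp, rule crossings_cong) (simp add: take_index_prefix)
    define E where "E m k = {\<omega> \<in> space M. 2 * m \<le> s (index_prefix k \<omega>)}" for m k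
    define N where "N = (\<Inter>m. \<Union>k. E m k)"
    have E_sets: "E m k \<in> sets M" for m k unfolding E_def by measurable
    then have N_sets: "N \<in> sets M" unfolding N_def by auto
    have le: "prob (\<Union>k. E m k) \<le> (a / c) ^ m" for m
    proof (rule LIMSEQ_le_const2[OF finite_Lim_measure_incseq])
      show "incseq (E m)"
        unfolding E_def s_prefix
        by (auto intro!: monoI intro: order_trans[OF _ monoD[OF mono_crossings]])
      show "\<exists>N. \<forall>k\<ge>N. prob (E m k) \<le> (a / c) ^ m"
        unfolding E_def s_prefix using prob_crossings_le[OF nonneg super ac] by blast
    qed (use E_sets in blast)
    have "prob N \<le> (a / c) ^ m" for m
      using finite_measure_mono[of N "\<Union>k. E m k"] le[of m] E_sets by (force simp: N_def)
    moreover have "(\<lambda>m. (a / c) ^ m) \<longlonglongrightarrow> 0" using ac by (intro LIMSEQ_realpow_zero) auto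
    ultimately have "prob N \<le> 0" by (intro LIMSEQ_le_const) auto
    then have "prob N = 0" using measure_nonneg[of M N] by linarith
    then have "N \<in> null_sets M" using N_sets by (intro null_setsI) (auto simp: emeasure_eq_measure)
    then have "AE \<omega> in M. \<omega> \<notin> N" by (rule AE_not_in)
    with AE_space show ?thesis
    proof eventually_elim
      case (elim \<omega>)
      then obtain m where "\<And>k. \<not> 2 * m \<le> crossings a c (?X \<omega>) k"
        by (auto simp: N_def E_def s_prefix)
      then show ?case using crossings_unbounded[of "?X \<omega>" a c "2 * m"] by blast
    qed
  qed
  then have osc': "AE \<omega> in M. \<forall>a\<in>\<rat>. \<forall>c\<in>\<rat>. 0 < a \<longrightarrow> a < c \<longrightarrow>
      \<not> ((\<exists>\<^sub>F k in sequentially. ?X \<omega> k \<le> a) \<and> (\<exists>\<^sub>F k in sequentially. c \<le> ?X \<omega> k))"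
    by (auto simp: AE_ball_countable countable_rat)
  have "(\<integral>\<^sup>+ \<omega>. liminf (\<lambda>k. ennreal (?X \<omega> k)) \<partial>M) \<le> liminf (\<lambda>k. \<integral>\<^sup>+ \<omega>. ennreal (?X \<omega> k) \<partial>M)"
    by (rule nn_integral_liminf) measurable
  also have "\<dots> \<le> ennreal (F [])"
  proof (rule Liminf_le)
    show "\<forall>\<^sub>F k in sequentially. (\<integral>\<^sup>+ \<omega>. ennreal (?X \<omega> k) \<partial>M) \<le> ennreal (F [])"
      using expectation_supermartingale_le[of F, OF super] nonneg
      by (simp add: nn_integral_eq_integral integrable_of_index_prefix ennreal_leI)
  qed simp
  finally have "(\<integral>\<^sup>+ \<omega>. liminf (\<lambda>k. ennreal (?X \<omega> k)) \<partial>M) \<noteq> \<infinity>"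
    using le_less_trans[OF _ ennreal_less_top] by (auto simp: less_top)
  then have "AE \<omega> in M. liminf (\<lambda>k. ennreal (?X \<omega> k)) \<noteq> \<infinity>"
    by (intro nn_integral_PInf_AE) measurable
  with osc' show ?thesis
  proof eventually_elim
    case (elim \<omega>)
    obtain B where B: "liminf (\<lambda>k. ennreal (?X \<omega> k)) = ennreal B" "0 \<le> B"
      using elim(2) by (cases "liminf (\<lambda>k. ennreal (?X \<omega> k))") auto
    have "\<exists>\<^sub>F k in sequentially. ?X \<omega> k \<le> B + 1"
    proof (rule ccontr)
      assume "\<not> ?thesis"
      then have "\<forall>\<^sub>F k in sequentially. ennreal (B + 1) \<le> ennreal (?X \<omega> k)"
        by (simp add: not_frequently) (auto elim!: eventually_mono intro: ennreal_leI)
      from Liminf_bounded[OF this] show False using B by (simp add: ennreal_le_iff)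
    qed
    then show ?case
      using elim(1) nonneg by (intro convergent_if_not_oscillating) auto
  qed
qed

end

section \<open>Randomized block coordinate descent\<close>

locale rbcd_problem =
  fixes V :: "'b::finite \<Rightarrow> 'a::euclidean_space set"
    and A :: "'b \<Rightarrow> 'a \<Rightarrow> 'y::real_inner"
    and y :: 'y
    and R :: "'a ^ 'b \<Rightarrow> real"
    and Rs :: "'b \<Rightarrow> 'a \<Rightarrow> real"
    and \<kappa> \<gamma> :: real
  assumes V: "\<And>i. subspace (V i)"
    and A: "\<And>i. bounded_linear_on (V i) (A i)"
    and y: "y \<in> block_op A ` block_space V"
    and \<kappa>: "\<kappa> > 0"
    and R: "strongly_convex_on (block_space V) \<kappa> R"
    and separable: "\<And>x. x \<in> block_space V \<Longrightarrow> R x = (\<Sum>i\<in>UNIV. Rs i (x $ i))"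
    and \<gamma>: "0 < \<gamma>" "\<gamma> * (onorm_on (block_space V) (block_op A))\<^sup>2 < 4 * \<kappa>"
begin

abbreviation X where "X \<equiv> block_space V"

abbreviation L where "L \<equiv> onorm_on X (block_op A)"

abbreviation step where "step \<equiv> rbcd_step V A y Rs \<gamma>"

lemmas X = subspace_block_space[of V, OF V]
lemmas block_A = bounded_linear_on_block_op[of V A, OF A]

section \<open>Optimal primal-dual pairs and the Bregman distance\<close>

definition residual where "residual p = block_op A (snd p) - y"

text \<open>The Bregman distance \<open>D\<^sub>\<xi> R(u, x)\<close> at \<open>p = (\<xi>, x)\<close>.\<close>

definition gap where "gap u p = R u - R (snd p) - fst p \<bullet> (u - snd p)"

text \<open>Blockwise form of \<open>\<xi> \<in> \<partial>R(x)\<close>.\<close>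

definition optimal_pair where
  "optimal_pair p \<longleftrightarrow> (\<forall>i. fst p $ i \<in> V i \<and>
     is_arg_min (\<lambda>z. Rs i z - fst p $ i \<bullet> z) (\<lambda>z. z \<in> V i) (snd p $ i))"

lemma optimal_pair_mem:
  assumes "optimal_pair p"
  shows "fst p \<in> X" "snd p \<in> X"
  using assms by (auto simp: optimal_pair_def block_space_def is_arg_min_def)

text \<open>By separability the tilted objective is a sum of block terms, each minimal at its own
  component.\<close>

lemma optimal_pair_minimizes:
  assumes "optimal_pair p"
  shows "is_arg_min (\<lambda>z. R z - fst p \<bullet> z) (\<lambda>z. z \<in> X) (snd p)"
proof -
  have eq: "R z - fst p \<bullet> z = (\<Sum>i\<in>UNIV. Rs i (z $ i) - fst p $ i \<bullet> z $ i)" if "z \<in> X" for z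
    using separable[OF that] by (simp add: inner_vec_def sum_subtractf)
  have "R (snd p) - fst p \<bullet> snd p \<le> R z - fst p \<bullet> z" if z: "z \<in> X" for z
    unfolding eq[OF z] eq[OF optimal_pair_mem(2)[OF assms]]
    using assms z by (intro sum_mono) (simp add: optimal_pair_def is_arg_min_linorder block_space_def)
  then show ?thesis using optimal_pair_mem[OF assms] by (simp add: is_arg_min_linorder)
qed

text \<open>The gap is the increment, from \<open>snd p\<close> to \<open>u\<close>, of
  \<open>R\<close> tilted by \<open>fst p\<close>; the growth lemma applies at the minimizer
  \<open>snd p\<close>.\<close>

lemma gap_ge:
  assumes "optimal_pair p" "u \<in> X"
  shows "\<kappa> * (norm (u - snd p))\<^sup>2 \<le> gap u p"
  using strongly_convex_on_growth[OF strongly_convex_on_diff_inner[OF R]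
      subspace_imp_convex[OF X] optimal_pair_minimizes[OF assms(1)] assms(2)]
  by (simp add: gap_def inner_simps)

text \<open>Along the isometric embedding \<open>axis i\<close>, \<open>R\<close> equals
  \<open>Rs i\<close> up to a constant. This guarantees that each block subproblem has a
  minimizer.\<close>

lemma strongly_convex_block: "strongly_convex_on (V i) \<kappa> (Rs i)"
proof -
  define C where "C = (\<Sum>j\<in>UNIV - {i}. Rs j 0)"
  have axis: "axis i z \<in> X" if "z \<in> V i" for z
    using that V by (auto simp: block_space_def axis_def subspace_0)
  have R_axis: "R (axis i z) = Rs i z + C" if "z \<in> V i" for z
  proof -
    have "R (axis i z) = Rs i (axis i z $ i) + (\<Sum>j\<in>UNIV - {i}. Rs j (axis i z $ j))"
      using separable[OF axis[OF that]] by (simp add: sum.remove[of UNIV i])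
    also have "(\<Sum>j\<in>UNIV - {i}. Rs j (axis i z $ j)) = C"
      unfolding C_def by (intro sum.cong) (auto simp: axis_def)
    finally show ?thesis by simp
  qed
  have norm_axis: "norm (axis i u - axis i v) = norm (u - v)" for u v :: 'a
  proof -
    have "axis i u - axis i v = axis i (u - v)" by (simp add: vec_eq_iff axis_def)
    then show ?thesis by (simp add: norm_eq_sqrt_inner inner_axis_axis)
  qed
  show ?thesis unfolding strongly_convex_on_def
  proof safe
    fix u v and t :: real
    assume uv: "u \<in> V i" "v \<in> V i" and t: "0 \<le> t" "t \<le> 1"
    have mem: "t *\<^sub>R u + (1 - t) *\<^sub>R v \<in> V i"
      using uv V by (intro subspace_add subspace_scale) auto
    have eq: "t *\<^sub>R axis i u + (1 - t) *\<^sub>R axis i v = axis i (t *\<^sub>R u + (1 - t) *\<^sub>R v)"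
      by (simp add: vec_eq_iff axis_def)
    from strongly_convex_onD[OF R axis[OF uv(1)] axis[OF uv(2)] t]
    show "Rs i (t *\<^sub>R u + (1 - t) *\<^sub>R v) + \<kappa> * t * (1 - t) * (norm (u - v))\<^sup>2
        \<le> t * Rs i u + (1 - t) * Rs i v"
      unfolding eq R_axis[OF mem] R_axis[OF uv(1)] R_axis[OF uv(2)] norm_axis
      by (simp add: algebra_simps)
  qed
qed

text \<open>Changing a single component of the minimizer of \<open>R\<close> leaves all other block
  terms fixed, so joint minimality implies blockwise minimality.\<close>

lemma optimal_pair_start: "optimal_pair (0, arg_min_on R X)"
proof -
  let ?x = "arg_min_on R X"
  have x: "?x \<in> X" "\<And>z. z \<in> X \<Longrightarrow> R ?x \<le> R z"
    using strongly_convex_on_arg_min[OF R \<kappa> X] by (auto simp: is_arg_min_linorder)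
  have "Rs i (?x $ i) \<le> Rs i z" if z: "z \<in> V i" for i z
  proof -
    define u where "u = (\<chi> j. if j = i then z else ?x $ j)"
    have u: "u \<in> X" using z x(1) by (auto simp: u_def block_space_def)
    have "(\<Sum>j\<in>UNIV - {i}. Rs j (u $ j)) = (\<Sum>j\<in>UNIV - {i}. Rs j (?x $ j))"
      by (intro sum.cong) (auto simp: u_def)
    with x(2)[OF u] show ?thesis
      by (simp add: separable[OF u] separable[OF x(1)] sum.remove[of UNIV i]) (simp add: u_def)
  qed
  then show ?thesis
    using x(1) V by (auto simp: optimal_pair_def is_arg_min_linorder block_space_def subspace_0)
qed

lemma optimal_pair_step:
  assumes "optimal_pair p"
  shows "optimal_pair (step i p)"
proof -
  have \<eta>: "fst p $ i - \<gamma> *\<^sub>R adjoint_on (V i) (A i) (block_op A (snd p) - y) \<in> V i"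
    using assms V adjoint_on(1)[OF V A]
    by (intro subspace_diff subspace_scale) (auto simp: optimal_pair_def)
  show ?thesis
    using assms \<eta> strongly_convex_on_arg_min[OF strongly_convex_on_diff_inner[OF strongly_convex_block] \<kappa> V]
    by (auto simp: optimal_pair_def rbcd_step_def Let_def split_beta)
qed

section \<open>One-step decrease of the Bregman distance\<close>

lemma fst_step:
  "fst (step i p) - fst p = axis i (- \<gamma> *\<^sub>R adjoint_on (V i) (A i) (residual p))"
  by (auto simp: rbcd_step_def Let_def split_beta vec_eq_iff axis_def residual_def)

text \<open>The exact change of the gap contains the Bregman distance of the new primal point from
  \<open>p\<close> with a minus sign. Its lower bound by strong convexity absorbs the primal
  displacement.\<close>

lemma gap_le:
  assumes p: "optimal_pair p" and q: "snd q \<in> X"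
  shows "gap u q \<le> gap u p + (fst q - fst p) \<bullet> (snd p - u) + (norm (fst q - fst p))\<^sup>2 / (4 * \<kappa>)"
proof -
  define d e where "d = fst q - fst p" and "e = snd q - snd p"
  \<comment> \<open>Young's inequality, weighted so that the quadratic term in \<open>e\<close> is
    exactly the one that strong convexity supplies.\<close>
  have "0 \<le> (norm (d - (2 * \<kappa>) *\<^sub>R e))\<^sup>2" by simp
  also have "\<dots> = (norm d)\<^sup>2 - 4 * \<kappa> * (d \<bullet> e) + 4 * \<kappa> * (\<kappa> * (norm e)\<^sup>2)"
    unfolding power2_norm_eq_inner by (simp add: inner_simps inner_commute algebra_simps)
  finally have "d \<bullet> e - \<kappa> * (norm e)\<^sup>2 \<le> (norm d)\<^sup>2 / (4 * \<kappa>)"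
    using \<kappa> by (simp add: field_simps)
  moreover have "\<kappa> * (norm e)\<^sup>2 \<le> R (snd q) - R (snd p) - fst p \<bullet> e"
    using gap_ge[OF p q] by (simp add: gap_def e_def)
  moreover have "gap u q = gap u p + d \<bullet> (snd p - u) + d \<bullet> e - (R (snd q) - R (snd p) - fst p \<bullet> e)"
    by (simp add: gap_def d_def e_def inner_simps algebra_simps)
  ultimately show ?thesis by (simp add: d_def)
qed

text \<open>The gain \<gamma> from the linear term of \<open>gap_le\<close> minus the loss from its
  quadratic term; the step size bound makes the difference positive.\<close>

definition rate where "rate = \<gamma> * (1 - \<gamma> * L\<^sup>2 / (4 * \<kappa>))"

lemma rate_pos: "0 < rate"
  using \<gamma> \<kappa> by (simp add: rate_def field_simps)

text \<open>The block adjoints assemble to the adjoint \<open>w\<close> of \<open>block_op A\<close>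
  at the residual. Summed over the blocks, the linear terms give the squared residual and the
  quadratic ones the squared norm of \<open>w\<close>, which \<open>L\<close> controls.\<close>

lemma sum_gap_step_le:
  assumes p: "optimal_pair p" and u: "u \<in> X" "block_op A u = y"
  shows "(\<Sum>i\<in>UNIV. gap u (step i p)) + rate * (norm (residual p))\<^sup>2 \<le> CARD('b) * gap u p"
proof -
  let ?r = "residual p"
  define w where "w = (\<chi> i. adjoint_on (V i) (A i) ?r)"
  have w: "w \<in> X" using adjoint_on(1)[OF V A] by (simp add: w_def block_space_def)
  have w_inner: "z \<bullet> w = block_op A z \<bullet> ?r" if "z \<in> X" for z
    using adjoint_on(2)[OF V A] that
    by (simp add: inner_vec_def w_def block_op_def inner_sum_left block_space_def)
  \<comment> \<open>Testing the adjoint identity with \<open>w\<close> itself bounds the adjoint by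
    the same constant \<open>L\<close>.\<close>
  have "(norm w)\<^sup>2 = block_op A w \<bullet> ?r" using w_inner[OF w] by (simp add: power2_norm_eq_inner)
  also have "\<dots> \<le> norm (block_op A w) * norm ?r" by (rule norm_cauchy_schwarz)
  also have "\<dots> \<le> L * norm w * norm ?r" by (intro mult_right_mono onorm_on[OF block_A w]) simp
  finally have "norm w * norm w \<le> norm w * (L * norm ?r)"
    by (simp add: power2_eq_square mult_ac)
  moreover have "0 \<le> L" using onorm_on_nonneg[OF block_A w] .
  ultimately have "norm w \<le> L * norm ?r"
    by (cases "w = 0") auto
  then have norm_w: "(norm w)\<^sup>2 \<le> L\<^sup>2 * (norm ?r)\<^sup>2"
    by (metis norm_ge_zero power_mono power_mult_distrib)
  have "gap u (step i p) \<le> gap u p - \<gamma> * ((snd p - u) $ i \<bullet> w $ i) + \<gamma>\<^sup>2 / (4 * \<kappa>) * (w $ i \<bullet> w $ i)" for i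
  proof -
    have d: "fst (step i p) - fst p = axis i (- \<gamma> *\<^sub>R w $ i)" by (simp add: fst_step w_def)
    have "(norm (axis i (- \<gamma> *\<^sub>R w $ i) :: 'a ^ 'b))\<^sup>2 = \<gamma>\<^sup>2 * (w $ i \<bullet> w $ i)"
      unfolding power2_norm_eq_inner inner_axis_axis by (simp add: power2_eq_square)
    moreover have "axis i (- \<gamma> *\<^sub>R w $ i) \<bullet> (snd p - u) = - \<gamma> * ((snd p - u) $ i \<bullet> w $ i)"
      by (simp add: inner_axis' inner_commute[of "w $ i"])
    ultimately show ?thesis
      using gap_le[OF p optimal_pair_mem(2)[OF optimal_pair_step[OF p]], of u i] unfolding d by simp
  qed
  then have "(\<Sum>i\<in>UNIV. gap u (step i p))
      \<le> (\<Sum>i\<in>UNIV. gap u p - \<gamma> * ((snd p - u) $ i \<bullet> w $ i) + \<gamma>\<^sup>2 / (4 * \<kappa>) * (w $ i \<bullet> w $ i))"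
    by (intro sum_mono)
  also have "\<dots> = CARD('b) * gap u p - \<gamma> * ((snd p - u) \<bullet> w) + \<gamma>\<^sup>2 / (4 * \<kappa>) * (w \<bullet> w)"
    by (simp add: sum.distrib sum_subtractf sum_distrib_left inner_vec_def)
  also have "(snd p - u) \<bullet> w = (norm ?r)\<^sup>2"
  proof -
    have "block_op A (snd p - u) = ?r"
      using bounded_linear_on_diff[OF block_A X optimal_pair_mem(2)[OF p] u(1)] u(2)
      by (simp add: residual_def)
    then show ?thesis
      using w_inner[OF subspace_diff[OF X optimal_pair_mem(2)[OF p] u(1)]]
      by (simp add: power2_norm_eq_inner)
  qed
  also have "\<gamma>\<^sup>2 / (4 * \<kappa>) * (w \<bullet> w) \<le> \<gamma>\<^sup>2 / (4 * \<kappa>) * (L\<^sup>2 * (norm ?r)\<^sup>2)"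
    using norm_w \<kappa> by (intro mult_left_mono) (auto simp: power2_norm_eq_inner)
  finally show ?thesis
    by (simp add: rate_def algebra_simps power2_eq_square)
qed

section \<open>Deterministic convergence along one path\<close>

lemma bounded_dual:
  assumes opt: "\<And>k. optimal_pair (p k)" and bnd: "bounded (range (\<lambda>k. snd (p k)))"
  shows "bounded (range (\<lambda>k :: nat. fst (p k)))"
proof -
  obtain B where B: "\<And>k. norm (snd (p k)) \<le> B" using bnd by (auto simp: bounded_iff)
  have "compact (cball 0 (B + 1) \<inter> X)" using X by (intro compact_Int_closed closed_subspace) auto
  moreover have "continuous_on (cball 0 (B + 1) \<inter> X) R"
    using strongly_convex_on_continuous[OF R _ X] \<kappa> by (auto intro: continuous_on_subset)
  ultimately have "bounded (R ` (cball 0 (B + 1) \<inter> X))"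
    by (intro compact_imp_bounded compact_continuous_image)
  then obtain C where "\<forall>z\<in>cball 0 (B + 1) \<inter> X. \<bar>R z\<bar> \<le> C" by (auto simp: bounded_iff)
  then have C: "\<bar>R z\<bar> \<le> C" if "norm z \<le> B + 1" "z \<in> X" for z using that by simp
  have "norm (fst (p k)) \<le> 2 * C" for k
  proof -
    let ?\<xi> = "fst (p k)" and ?x = "snd (p k)"
    \<comment> \<open>A unit move in the direction of the dual vector: the subgradient inequality
      there bounds its norm by the variation of \<open>R\<close> on the larger ball. If the dual
      vector is 0, \<open>sgn\<close> gives no move.\<close>
    let ?z = "?x + sgn ?\<xi>"
    have mem: "?x \<in> X" "?\<xi> \<in> X" using optimal_pair_mem[OF opt] by auto
    have z: "?z \<in> X" using mem X by (simp add: sgn_div_norm subspace_add subspace_scale)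
    have "norm ?z \<le> B + 1" using B[of k] norm_triangle_ineq[of ?x "sgn ?\<xi>"] by (simp add: norm_sgn split: if_splits)
    then have "\<bar>R ?z\<bar> \<le> C" "\<bar>R ?x\<bar> \<le> C" using C z mem B[of k] by auto
    moreover have "?\<xi> \<bullet> sgn ?\<xi> = norm ?\<xi>"
      by (cases "?\<xi> = 0") (simp_all add: sgn_div_norm power2_norm_eq_inner[symmetric] power2_eq_square)
    moreover have "0 \<le> \<kappa> * (norm (?z - ?x))\<^sup>2" using \<kappa> by simp
    ultimately show ?thesis using gap_ge[OF opt z, of k] by (simp add: gap_def)
  qed
  then show ?thesis by (auto simp: bounded_iff)
qed

text \<open>Opial-type argument for a fixed path: the gap to a cluster point converges along the
  whole sequence and vanishes along a subsequence, so it tends to 0.\<close>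

lemma primal_convergence:
  assumes opt: "\<And>k. optimal_pair (p k)" and res: "(\<lambda>k. residual (p k)) \<longlonglongrightarrow> 0"
    and u: "u \<in> X" "block_op A u = y"
    and B: "{v \<in> X. block_op A v = 0} \<subseteq> span B"
    and gap0: "convergent (\<lambda>k. gap u (p k))"
    and gapB: "\<And>v. v \<in> B \<Longrightarrow> convergent (\<lambda>k. gap (u + v) (p k))"
  shows "\<exists>x\<in>X. block_op A x = y \<and> (\<lambda>k. snd (p k)) \<longlonglongrightarrow> x"
proof -
  have gap_add: "gap (u + v) q = gap u q + R (u + v) - R u - fst q \<bullet> v" for v q
    by (simp add: gap_def inner_simps)
  \<comment> \<open>Differences of two convergent gaps reveal the dual iterates on \<open>B\<close>;
    linearity extends this to the span.\<close>
  have dual: "convergent (\<lambda>k. fst (p k) \<bullet> v)" if "v \<in> span B" for v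
    using that
  proof (induction rule: span_induct_alt)
    case base
    then show ?case by (simp add: convergent_const)
  next
    case (step c v w)
    have "convergent (\<lambda>k. gap u (p k) - gap (u + v) (p k) + (R (u + v) - R u))"
      using gap0 gapB[OF step(1)] by (intro convergent_add convergent_diff convergent_const)
    then have "convergent (\<lambda>k. fst (p k) \<bullet> v)" by (simp add: gap_add)
    then show ?case using step(2)
      by (simp add: inner_simps) (intro convergent_add convergent_mult convergent_const)
  qed
  have gap_conv: "convergent (\<lambda>k. gap x (p k))" if x: "x \<in> X" "block_op A x = y" for x
  proof -
    have "x - u \<in> span B"
      using B subspace_diff[OF X x(1) u(1)] bounded_linear_on_diff[OF block_A X x(1) u(1)] x u by auto
    then have "convergent (\<lambda>k. gap u (p k) + (R x - R u) - fst (p k) \<bullet> (x - u))"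
      using gap0 dual by (intro convergent_add convergent_diff convergent_const)
    moreover have "gap x q = gap u q + (R x - R u) - fst q \<bullet> (x - u)" for q
      using gap_add[of "x - u" q] by simp
    ultimately show ?thesis by simp
  qed
  obtain C where "\<And>k. norm (gap u (p k)) \<le> C"
    using BseqD[OF convergent_imp_Bseq[OF gap0]] by blast
  then have C: "gap u (p k) \<le> C" for k by (metis abs_le_D1 real_norm_def)
  have bnd: "bounded (range (\<lambda>k. snd (p k)))"
  proof -
    have "norm (snd (p k) - u) \<le> sqrt (C / \<kappa>)" for k
    proof (rule real_le_rsqrt)
      have "\<kappa> * (norm (u - snd (p k)))\<^sup>2 \<le> C" using gap_ge[OF opt u(1)] C by (rule order_trans)
      then show "(norm (snd (p k) - u))\<^sup>2 \<le> C / \<kappa>"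
        using \<kappa> by (simp add: le_divide_eq norm_minus_commute mult.commute)
    qed
    then have "bounded ((\<lambda>k. snd (p k) - u) ` UNIV)" by (auto simp: bounded_iff)
    then have "bounded ((\<lambda>z. z + u) ` range (\<lambda>k. snd (p k) - u))"
      by (subst add.commute) (rule bounded_translation)
    then show ?thesis by (simp add: image_image)
  qed
  then obtain x r where r: "strict_mono r" and "((\<lambda>k. snd (p k)) \<circ> r) \<longlonglongrightarrow> x"
    using bounded_imp_convergent_subsequence[OF bnd] by blast
  then have sub: "(\<lambda>k. snd (p (r k))) \<longlonglongrightarrow> x" by (simp add: o_def)
  have mem: "snd (p k) \<in> X" for k using optimal_pair_mem[OF opt] by simp
  have x: "x \<in> X" by (rule closed_sequentially[OF closed_subspace[OF X] _ sub]) (simp add: mem)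
  have "block_op A x = y"
  proof -
    have "(\<lambda>k. L * norm (snd (p (r k)) - x)) \<longlonglongrightarrow> L * norm (x - x)"
      by (intro tendsto_intros sub)
    then have "(\<lambda>k. L * norm (snd (p (r k)) - x)) \<longlonglongrightarrow> 0" by simp
    then have "(\<lambda>k. block_op A (snd (p (r k)) - x)) \<longlonglongrightarrow> 0"
      by (rule Lim_null_comparison[rotated])
        (auto intro!: always_eventually onorm_on[OF block_A] subspace_diff[OF X] mem x)
    moreover have "block_op A (snd (p (r k)) - x) = residual (p (r k)) + (y - block_op A x)" for k
      by (simp add: bounded_linear_on_diff[OF block_A X mem x] residual_def)
    moreover have "(\<lambda>k. residual (p (r k)) + (y - block_op A x)) \<longlonglongrightarrow> 0 + (y - block_op A x)"
      using LIMSEQ_subseq_LIMSEQ[OF res r] by (intro tendsto_add tendsto_const) (simp add: o_def)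
    ultimately have "y - block_op A x = 0" by (auto dest: LIMSEQ_unique)
    then show ?thesis by simp
  qed
  obtain g where g: "(\<lambda>k. gap x (p k)) \<longlonglongrightarrow> g"
    using gap_conv[OF x \<open>block_op A x = y\<close>] by (auto simp: convergent_def)
  \<comment> \<open>\<open>R\<close> is continuous, and the pairing is a bounded dual sequence times
    a primal null sequence.\<close>
  have "(\<lambda>k. gap x (p (r k))) \<longlonglongrightarrow> R x - R x - 0"
    unfolding gap_def
  proof (intro tendsto_diff tendsto_const)
    show "(\<lambda>k. R (snd (p (r k)))) \<longlonglongrightarrow> R x"
      using continuous_on_tendsto_compose[OF strongly_convex_on_continuous[OF R _ X] sub x] \<kappa> mem by simp
    obtain K where "\<And>k. norm (fst (p k)) \<le> K"
      using bounded_dual[OF opt bnd] by (auto simp: bounded_iff)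
    then have "Bfun (\<lambda>k. fst (p (r k))) sequentially" by (intro BfunI always_eventually) blast
    moreover have "(\<lambda>k. x - snd (p (r k))) \<longlonglongrightarrow> 0"
      using tendsto_diff[OF tendsto_const sub, of x] by simp
    ultimately show "(\<lambda>k. fst (p (r k)) \<bullet> (x - snd (p (r k)))) \<longlonglongrightarrow> 0"
      by (simp add: tendsto_Zfun_iff bounded_bilinear.Bfun_prod_Zfun[OF bounded_bilinear_inner])
  qed
  with LIMSEQ_subseq_LIMSEQ[OF g r] have "g = 0" by (auto simp: o_def dest: LIMSEQ_unique)
  then have "(\<lambda>k. gap x (p k) / \<kappa>) \<longlonglongrightarrow> 0" using tendsto_divide_zero[OF g[unfolded \<open>g = 0\<close>]] by simp
  then have "(\<lambda>k. (norm (snd (p k) - x))\<^sup>2) \<longlonglongrightarrow> 0"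
    by (rule Lim_null_comparison[rotated])
      (use gap_ge[OF opt x] \<kappa> in \<open>auto intro!: always_eventually simp: le_divide_eq norm_minus_commute mult.commute\<close>)
  then have "(\<lambda>k. norm (snd (p k) - x)) \<longlonglongrightarrow> 0" by simp
  then have "(\<lambda>k. snd (p k)) \<longlonglongrightarrow> x" by (rule LIM_zero_cancel[OF tendsto_norm_zero_cancel])
  then show ?thesis using x \<open>block_op A x = y\<close> by blast
qed

end

section \<open>Almost sure convergence of the random iterates\<close>

lemma rbcd_cong:
  "(\<And>j. j < k \<Longrightarrow> idx j = idx' j) \<Longrightarrow> rbcd V A y R Rs \<gamma> idx k = rbcd V A y R Rs \<gamma> idx' k"
  by (induction k) auto

locale rbcd_random = rbcd_problem V A y R Rs \<kappa> \<gamma> + uniform_indices M I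
  for V :: "'b::finite \<Rightarrow> 'a::euclidean_space set" and A :: "'b \<Rightarrow> 'a \<Rightarrow> 'y::real_inner"
    and y R Rs \<kappa> \<gamma> and M :: "'w measure" and I :: "nat \<Rightarrow> 'w \<Rightarrow> 'b"
begin

text \<open>The iterates in the word form of the supermartingale lemmas. Only the first
  \<open>length l\<close> indices are read, so \<open>l ! j\<close> is never evaluated beyond the
  end of the list.\<close>

definition state :: "'b list \<Rightarrow> ('a ^ 'b) \<times> ('a ^ 'b)" where
  "state l = rbcd V A y R Rs \<gamma> (\<lambda>j. l ! j) (length l)"

lemma state_snoc: "state (l @ [i]) = step i (state l)"
proof -
  have "rbcd V A y R Rs \<gamma> (\<lambda>j. (l @ [i]) ! j) (length l) = state l"
    unfolding state_def by (rule rbcd_cong) (simp add: nth_append)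
  then show ?thesis by (simp add: state_def)
qed

lemma state_index_prefix: "state (index_prefix k \<omega>) = rbcd V A y R Rs \<gamma> (\<lambda>j. I j \<omega>) k"
  unfolding state_def length_index_prefix by (rule rbcd_cong) (simp add: index_prefix_def)

lemma optimal_pair_state: "optimal_pair (state l)"
proof (induction l rule: rev_induct)
  case Nil
  show ?case using optimal_pair_start by (simp add: state_def)
next
  case (snoc i l)
  then show ?case unfolding state_snoc by (rule optimal_pair_step)
qed

lemma gap_state_nonneg: "u \<in> X \<Longrightarrow> 0 \<le> gap u (state l)"
  using gap_ge[OF optimal_pair_state] \<kappa> by (meson less_imp_le mult_nonneg_nonneg order_trans zero_le_power2)

lemma AE_convergent_gap:
  assumes u: "u \<in> X" "block_op A u = y"
  shows "AE \<omega> in M. convergent (\<lambda>k. gap u (state (index_prefix k \<omega>)))"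
proof (rule AE_convergent_supermartingale)
  fix l
  have "0 \<le> rate * (norm (residual (state l)))\<^sup>2" using rate_pos by simp
  then show "(\<Sum>i\<in>UNIV. gap u (state (l @ [i]))) \<le> CARD('b) * gap u (state l)"
    using sum_gap_step_le[OF optimal_pair_state u, of l] by (simp add: state_snoc)
qed (rule gap_state_nonneg[OF u(1)])

text \<open>The gap plus the accumulated expected decrease is a supermartingale as well, so that the
  accumulated decrease is a difference of convergent sequences.\<close>

lemma AE_residual_tendsto_0: "AE \<omega> in M. (\<lambda>k. residual (state (index_prefix k \<omega>))) \<longlonglongrightarrow> 0"
proof -
  obtain u where u: "u \<in> X" "block_op A u = y" using y by auto
  \<comment> \<open>\<open>sum_gap_step_le\<close> bounds a sum over all blocks, whence the division
    by \<open>CARD('b)\<close>.\<close>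
  let ?c = "rate / CARD('b)"
  \<comment> \<open>The residual of \<open>state l\<close> itself is left out, so
    \<open>S (l @ [i])\<close> does not depend on \<open>i\<close>.\<close>
  define S where "S l = (\<Sum>j<length l. (norm (residual (state (take j l))))\<^sup>2)" for l
  have S_snoc: "S (l @ [i]) = S l + (norm (residual (state l)))\<^sup>2" for l i
    by (simp add: S_def)
  have S_prefix: "S (index_prefix k \<omega>) = (\<Sum>j<k. (norm (residual (state (index_prefix j \<omega>))))\<^sup>2)" for k \<omega>
    unfolding S_def by (simp add: take_index_prefix)
  have "AE \<omega> in M. convergent (\<lambda>k. (\<lambda>l. gap u (state l) + ?c * S l) (index_prefix k \<omega>))"
  proof (rule AE_convergent_supermartingale)
    show "0 \<le> gap u (state l) + ?c * S l" for l
      using gap_state_nonneg[OF u(1)] rate_pos by (simp add: S_def sum_nonneg)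
    show "(\<Sum>i\<in>UNIV. gap u (state (l @ [i])) + ?c * S (l @ [i])) \<le> CARD('b) * (gap u (state l) + ?c * S l)" for l
      using sum_gap_step_le[OF optimal_pair_state u, of l]
      by (simp add: state_snoc S_snoc sum.distrib algebra_simps)
  qed
  with AE_convergent_gap[OF u] show ?thesis
  proof eventually_elim
    case (elim \<omega>)
    have "convergent (\<lambda>k. 1 / ?c * (gap u (state (index_prefix k \<omega>)) + ?c * S (index_prefix k \<omega>)
        - gap u (state (index_prefix k \<omega>))))"
      using elim by (intro convergent_mult convergent_const convergent_diff) auto
    then have "summable (\<lambda>j. (norm (residual (state (index_prefix j \<omega>))))\<^sup>2)"
      using rate_pos by (simp add: S_prefix summable_iff_convergent)
    then have "(\<lambda>j. (norm (residual (state (index_prefix j \<omega>))))\<^sup>2) \<longlonglongrightarrow> 0"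
      by (rule summable_LIMSEQ_zero)
    then have "(\<lambda>j. norm (residual (state (index_prefix j \<omega>)))) \<longlonglongrightarrow> 0" by simp
    then show ?case by (rule tendsto_norm_zero_cancel)
  qed
qed

lemma AE_primal_convergence:
  "AE \<omega> in M. \<exists>x\<in>X. block_op A x = y \<and> (\<lambda>k. snd (state (index_prefix k \<omega>))) \<longlonglongrightarrow> x"
proof -
  obtain u where u: "u \<in> X" "block_op A u = y" using y by auto
  \<comment> \<open>A basis is finite, so the exceptional sets of the solutions \<open>u + v\<close>
    unite to one null set.\<close>
  obtain B where B: "B \<subseteq> {v \<in> X. block_op A v = 0}" "independent B" "{v \<in> X. block_op A v = 0} \<subseteq> span B"
    by (rule basis_exists[of "{v \<in> X. block_op A v = 0}"]) (rule that)
  have "AE \<omega> in M. \<forall>v\<in>B. convergent (\<lambda>k. gap (u + v) (state (index_prefix k \<omega>)))"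
  proof (rule AE_finite_allI)
    show "finite B" using B(2) by (rule independent_imp_finite)
    show "AE \<omega> in M. convergent (\<lambda>k. gap (u + v) (state (index_prefix k \<omega>)))" if "v \<in> B" for v
    proof (rule AE_convergent_gap)
      have v: "v \<in> X" "block_op A v = 0" using that B(1) by auto
      show "u + v \<in> X" using X u(1) v(1) by (rule subspace_add)
      show "block_op A (u + v) = y"
        using block_A u v unfolding bounded_linear_on_def by simp
    qed
  qed
  with AE_convergent_gap[OF u] AE_residual_tendsto_0 show ?thesis
  proof eventually_elim
    case (elim \<omega>)
    then show ?case by (intro primal_convergence[OF optimal_pair_state _ u B(3)]) auto
  qed
qed

lemma rbcd_converges_AE:
  "\<exists>xbar \<in> M \<rightarrow>\<^sub>M restrict_space borel X. AE \<omega> in M. block_op A (xbar \<omega>) = y \<and>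
     (\<lambda>k. snd (rbcd V A y R Rs \<gamma> (\<lambda>j. I j \<omega>) k)) \<longlonglongrightarrow> xbar \<omega>"
proof -
  let ?x = "\<lambda>\<omega> k. snd (state (index_prefix k \<omega>))"
  obtain N where
    N: "\<And>\<omega>. \<omega> \<in> space M - N \<Longrightarrow> \<exists>x\<in>X. block_op A x = y \<and> ?x \<omega> \<longlonglongrightarrow> x"
      "N \<in> null_sets M"
    by (rule AE_E3[OF AE_primal_convergence]) (rule that)
  \<comment> \<open>A pointwise limit is measurable; the value 0 on the null set lies in the
    subspace, so \<open>xbar\<close> has values in \<open>X\<close> everywhere.\<close>
  define xbar where "xbar \<omega> = (if \<omega> \<in> N then 0 else lim (?x \<omega>))" for \<omega>
  have xbar: "xbar \<omega> \<in> X \<and> block_op A (xbar \<omega>) = y \<and> ?x \<omega> \<longlonglongrightarrow> xbar \<omega>"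
    if \<omega>: "\<omega> \<in> space M - N" for \<omega>
  proof -
    obtain x where x: "x \<in> X" "block_op A x = y" "?x \<omega> \<longlonglongrightarrow> x" using N(1)[OF \<omega>] by blast
    have "xbar \<omega> = x" using \<omega> limI[OF x(3)] by (simp add: xbar_def)
    with x show ?thesis by simp
  qed
  have "xbar \<in> borel_measurable M"
    unfolding xbar_def using N(2) by (intro measurable_If_set borel_measurable_lim_metric) auto
  moreover have "xbar \<omega> \<in> X" if "\<omega> \<in> space M" for \<omega>
    using xbar[of \<omega>] that subspace_0[OF X] by (cases "\<omega> \<in> N") (auto simp: xbar_def)
  ultimately have "xbar \<in> M \<rightarrow>\<^sub>M restrict_space borel X"
    by (intro measurable_restrict_space2) auto
  moreover have "AE \<omega> in M. block_op A (xbar \<omega>) = y \<and> ?x \<omega> \<longlonglongrightarrow> xbar \<omega>"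
    using AE_not_in[OF N(2)] AE_space by eventually_elim (use xbar in blast)
  ultimately show ?thesis unfolding state_index_prefix by blast
qed

end

theorem theorem3p3:
  fixes V :: "'b::finite \<Rightarrow> 'a::euclidean_space set"
    and A :: "'b \<Rightarrow> 'a \<Rightarrow> 'y::{real_inner, complete_space}"
    and y :: 'y
    and R :: "'a ^ 'b \<Rightarrow> real"
    and Rs :: "'b \<Rightarrow> 'a \<Rightarrow> real"
    and \<kappa> \<gamma> :: real
    and M :: "'w measure"
    and I :: "nat \<Rightarrow> 'w \<Rightarrow> 'b"
  assumes "\<And>i. subspace (V i)"
    and "\<And>i. bounded_linear_on (V i) (A i)"
    and "y \<in> block_op A ` block_space V"
    and "lsc_on (block_space V) R"
    and "\<kappa> > 0"
    and "strongly_convex_on (block_space V) \<kappa> R"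
    and "\<And>x. x \<in> block_space V \<Longrightarrow> R x = (\<Sum>i\<in>UNIV. Rs i (x $ i))"
    and "prob_space M"
    and "prob_space.indep_vars M (\<lambda>_. count_space UNIV) I UNIV"
    and "\<And>k. distr M (count_space UNIV) (I k) = uniform_count_measure UNIV"
    and "0 < \<gamma>"
    and "ereal \<gamma> < ereal (4 * \<kappa>) / ereal ((onorm_on (block_space V) (block_op A))\<^sup>2)"
  shows "\<exists>xbar \<in> M \<rightarrow>\<^sub>M restrict_space borel (block_space V).
           AE \<omega> in M. block_op A (xbar \<omega>) = y \<and>
             (\<lambda>k. snd (rbcd V A y R Rs \<gamma> (\<lambda>j. I j \<omega>) k)) \<longlonglongrightarrow> xbar \<omega>"
proof -
  have "\<gamma> * (onorm_on (block_space V) (block_op A))\<^sup>2 < 4 * \<kappa>"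
    using assms(5,12) by (cases "onorm_on (block_space V) (block_op A) = 0") (simp_all add: field_simps)
  then interpret rbcd_problem V A y R Rs \<kappa> \<gamma>
    using assms(1-3,5-7,11) by (intro rbcd_problem.intro)
  interpret uniform_indices M I
    using assms(8-10) by (simp add: uniform_indices_def uniform_indices_axioms_def)
  interpret rbcd_random V A y R Rs \<kappa> \<gamma> M I ..
  show ?thesis by (rule rbcd_converges_AE)
qed

end
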